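(* Let $k\geq 1$ be an integer and let $G$ be an edge-colored complete graph on $n$ vertices. If $\Delta^{mon}(G)\leq n-3k+1$, then either $G$ contains $k$ pairwise vertex-disjoint properly colored cycles of length at most $4$, or each vertex of $G$ is contained in a properly colored cycle of length $3$ or $4$.
   Context: All graphs are finite and simple. An edge-colored graph is a graph with an arbitrary mapping $col:E(G)\to\mathbb{N}$ (not necessarily a proper coloring). For a color $i$, $G^i$ is the spanning subgraph of $G$ formed by the edges of color $i$, and $\Delta^{mon}(G)=\max_i \Delta(G^i)$ (maximum over the colors $i$ appearing in $G$) is the maximum monochromatic degree. A cycle is properly colored (PC) if any two adjacent edges of the cycle have distinct colors. "Either ... or" is inclusive. *)

theory Defs
  imports Main
begin

text \<open>
  A graph is given by a vertex set \<open>V\<close> and a set \<open>E\<close> of two-element subsets of \<open>V\<close>.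
  A colouring is a total function on sets of vertices, but only its values on \<open>E\<close> are ever used.
\<close>

definition simple_graph :: "'a set \<Rightarrow> 'a set set \<Rightarrow> bool" where
  "simple_graph V E \<longleftrightarrow> finite V \<and> (\<forall>e\<in>E. e \<subseteq> V \<and> card e = 2)"

definition complete_graph :: "'a set \<Rightarrow> 'a set set \<Rightarrow> bool" where
  "complete_graph V E \<longleftrightarrow>
     simple_graph V E \<and> (\<forall>u\<in>V. \<forall>v\<in>V. u \<noteq> v \<longrightarrow> {u, v} \<in> E)"

definition vertex_degree :: "'a set set \<Rightarrow> 'a \<Rightarrow> nat" where
  "vertex_degree E v = card {e \<in> E. v \<in> e}"

text \<open>Inserting \<open>0\<close> only fixes the value of a maximum over the empty set, which is otherwise
  unspecified.\<close>

definition max_degree :: "'a set \<Rightarrow> 'a set set \<Rightarrow> nat" where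
  "max_degree V E = Max (insert 0 (vertex_degree E ` V))"

definition color_class :: "'a set set \<Rightarrow> ('a set \<Rightarrow> nat) \<Rightarrow> nat \<Rightarrow> 'a set set" where
  "color_class E col i = {e \<in> E. col e = i}"

definition max_mono_degree :: "'a set \<Rightarrow> 'a set set \<Rightarrow> ('a set \<Rightarrow> nat) \<Rightarrow> nat" where
  "max_mono_degree V E col = Max (insert 0 ((\<lambda>i. max_degree V (color_class E col i)) ` (col ` E)))"

text \<open>A cycle is the list of its vertices in cyclic order, without repeating the first one at
  the end, so its length is the length of the list.\<close>

definition cycle_edges :: "'a list \<Rightarrow> 'a set set" where
  "cycle_edges c = {{c ! i, c ! (Suc i mod length c)} | i. i < length c}"

definition is_cycle :: "'a set \<Rightarrow> 'a set set \<Rightarrow> 'a list \<Rightarrow> bool" where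
  "is_cycle V E c \<longleftrightarrow>
     length c \<ge> 3 \<and> distinct c \<and> set c \<subseteq> V \<and> cycle_edges c \<subseteq> E"

definition pc_cycle :: "'a set \<Rightarrow> 'a set set \<Rightarrow> ('a set \<Rightarrow> nat) \<Rightarrow> 'a list \<Rightarrow> bool" where
  "pc_cycle V E col c \<longleftrightarrow> is_cycle V E c \<and>
     (\<forall>e\<in>cycle_edges c. \<forall>f\<in>cycle_edges c. e \<noteq> f \<and> e \<inter> f \<noteq> {} \<longrightarrow> col e \<noteq> col f)"

end

theory Submission
  imports Defs
begin

text \<open>
  Suppose that \<open>v\<close> lies on no properly coloured cycle of length \<open>3\<close> or \<open>4\<close>. Partition the other
  vertices by the colour of their edge to \<open>v\<close>. There is no properly coloured triangle at \<open>v\<close>, so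
  an edge \<open>xy\<close> between two parts has the colour of \<open>vx\<close> or of \<open>vy\<close>; orient it from \<open>x\<close> to \<open>y\<close> in
  the latter case. This gives a multipartite tournament whose directed cycles are properly coloured.
  If \<open>x\<close> has an in-neighbour then, there being no properly coloured 4-cycle at \<open>v\<close>, every edge at
  \<open>x\<close> that is not an arc leaving \<open>x\<close> has the colour of \<open>vx\<close>. Hence \<open>x\<close> has out-degree at least
  \<open>3 k - 2\<close>, and its out-neighbours again have an in-neighbour.

  In a multipartite tournament with minimum out-degree at least \<open>3 k - 2\<close> one removes short cycles
  greedily, always inside a terminal strong component. Deleting a triangle costs each vertex at
  most three out-neighbours. If the component has no triangle, it has a directed 4-cycle, and no
  vertex dominates all of it, so again at most three out-neighbours are lost.
\<close>

section \<open>Short cycles in multipartite tournaments\<close>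

locale multipartite_tournament =
  fixes X :: "'a set" and arc :: "'a \<Rightarrow> 'a \<Rightarrow> bool" and part :: "'a \<Rightarrow> 'b"
  assumes finite_X: "finite X"
    and arc_part: "arc x y \<Longrightarrow> part x \<noteq> part y"
    and arc_asym: "arc x y \<Longrightarrow> \<not> arc y x"
    and arc_total: "x \<in> X \<Longrightarrow> y \<in> X \<Longrightarrow> part x \<noteq> part y \<Longrightarrow> arc x y \<or> arc y x"
begin

text \<open>Distinctness is implied: arcs join different parts, and asymmetry separates opposite
  vertices of a 4-cycle.\<close>

definition short_dicycle :: "'a list \<Rightarrow> bool" where
  "short_dicycle c \<longleftrightarrow>
     (\<exists>x y z. c = [x, y, z] \<and> arc x y \<and> arc y z \<and> arc z x) \<or>
     (\<exists>x y z w. c = [x, y, z, w] \<and> arc x y \<and> arc y z \<and> arc z w \<and> arc w x)"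

definition triangle_free :: "'a set \<Rightarrow> bool" where
  "triangle_free W \<longleftrightarrow> \<not> (\<exists>x\<in>W. \<exists>y\<in>W. \<exists>z\<in>W. arc x y \<and> arc y z \<and> arc z x)"

text \<open>Strong connectedness, phrased through out-closed subsets to avoid directed paths.\<close>

definition strong :: "'a set \<Rightarrow> bool" where
  "strong W \<longleftrightarrow> W \<noteq> {} \<and>
     (\<forall>Z\<subseteq>W. Z \<noteq> {} \<longrightarrow> (\<forall>x\<in>Z. \<forall>y\<in>W. arc x y \<longrightarrow> y \<in> Z) \<longrightarrow> Z = W)"

lemma strongD:
  assumes "strong W" "Z \<subseteq> W" "z \<in> Z" "\<And>x y. x \<in> Z \<Longrightarrow> y \<in> W \<Longrightarrow> arc x y \<Longrightarrow> y \<in> Z"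
  shows "Z = W"
  using assms unfolding strong_def by blast

text \<open>A failure of strongness yields a smaller nonempty out-closed set; out-closedness is
  transitive, so the descent ends in a strong one.\<close>

lemma terminal_strong_subset:
  assumes "finite Y" "Y \<noteq> {}"
  shows "\<exists>W\<subseteq>Y. strong W \<and> (\<forall>x\<in>W. \<forall>y\<in>Y. arc x y \<longrightarrow> y \<in> W)"
  using assms
proof (induction Y rule: finite_psubset_induct)
  case (psubset Y)
  show ?case
  proof (cases "strong Y")
    case True
    then show ?thesis by blast
  next
    case False
    then obtain Z where Z: "Z \<subset> Y" "Z \<noteq> {}" "\<forall>x\<in>Z. \<forall>y\<in>Y. arc x y \<longrightarrow> y \<in> Z"
      using psubset.prems unfolding strong_def by blast
    obtain W where W: "W \<subseteq> Z" "strong W" "\<forall>x\<in>W. \<forall>y\<in>Z. arc x y \<longrightarrow> y \<in> W"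
      using psubset.IH[OF Z(1,2)] by blast
    have "\<forall>x\<in>W. \<forall>y\<in>Y. arc x y \<longrightarrow> y \<in> W" using W(1,3) Z(3) by blast
    moreover have "W \<subseteq> Y" using W(1) Z(1) by blast
    ultimately show ?thesis using W(2) by blast
  qed
qed

section \<open>Triangle-free strong sets\<close>

lemma strong_has_4_cycle:
  assumes "W \<subseteq> X" "strong W" "triangle_free W" "\<And>x. x \<in> W \<Longrightarrow> \<exists>y\<in>W. arc x y"
  shows "\<exists>x\<in>W. \<exists>y\<in>W. \<exists>z\<in>W. \<exists>w\<in>W. arc x y \<and> arc y z \<and> arc z w \<and> arc w x"
proof (rule ccontr)
  assume no4: "\<not> ?thesis"
  obtain a b where ab: "a \<in> W" "b \<in> W" "arc a b"
    using assms(2,4) unfolding strong_def by blast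
  have no3: "\<not> (arc x y \<and> arc y z \<and> arc z x)" if "x \<in> W" "y \<in> W" "z \<in> W" for x y z
    using assms(3) that unfolding triangle_free_def by blast
  text \<open>An arc leaving \<open>Z\<close> would start a path of length three to \<open>a\<close>, hence close a triangle or a
    4-cycle; so \<open>Z\<close> is out-closed although it misses \<open>a\<close>.\<close>
  define Z where "Z = {z \<in> W. z \<noteq> a \<and> \<not> arc z a \<and> \<not> (\<exists>y\<in>W. arc z y \<and> arc y a)}"
  have "Z = W"
  proof (rule strongD[OF assms(2)])
    show "Z \<subseteq> W" unfolding Z_def by blast
    show "b \<in> Z" unfolding Z_def using ab arc_asym no3 by blast
  next
    fix z w assume z: "z \<in> Z" and w: "w \<in> W" "arc z w"
    show "w \<in> Z"
    proof (rule ccontr)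
      assume "w \<notin> Z"
      then obtain y where y: "y \<in> W" "arc w y" "arc y a" and "\<not> arc w a" "w \<noteq> a"
        using z w unfolding Z_def by blast
      then have "part w = part a"
        using no3 arc_total ab(1) w(1) assms(1) by blast
      then have "part z \<noteq> part a" using arc_part w(2) by metis
      then have "arc a z"
        using arc_total ab(1) z assms(1) unfolding Z_def by blast
      then show False using no4 ab(1) z w y unfolding Z_def by blast
    qed
  qed
  then show False using ab(1) unfolding Z_def by blast
qed

lemma strong_no_dominating_vertex:
  assumes "W \<subseteq> X" "strong W" "triangle_free W"
    and in_W: "p \<in> W" "q \<in> W" "r \<in> W" "s \<in> W"
    and cyc: "arc p q" "arc q r" "arc r s" "arc s p"
    and uW: "u \<in> W"
  shows "\<not> (arc u p \<and> arc u q \<and> arc u r \<and> arc u s)"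
proof
  assume u: "arc u p \<and> arc u q \<and> arc u r \<and> arc u s"
  have no3: "\<not> (arc x y \<and> arc y z \<and> arc z x)" if "x \<in> W" "y \<in> W" "z \<in> W" for x y z
    using assms(3) that unfolding triangle_free_def by blast
  have tot: "arc x y \<or> arc y x" if "x \<in> W" "y \<in> W" "part x \<noteq> part y" for x y
    using arc_total that assms(1) by blast
  \<comment> \<open>A chord between opposite vertices would close a triangle with two arcs of the
    cycle.\<close>
  have parts: "part p = part r" "part q = part s" "part p \<noteq> part q"
    using tot no3 in_W cyc arc_part by blast+
  define A where "A = {a \<in> W. arc a p \<and> arc a q \<and> arc a r \<and> arc a s}"
  text \<open>\<open>Z\<close> is out-closed: given an arc from \<open>z \<in> Z\<close> to \<open>y\<close> and one from \<open>y\<close> to \<open>a \<in> A\<close>, the vertex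
    \<open>z\<close> lies in the part of \<open>a\<close>, so \<open>p\<close> and \<open>q\<close> dominate \<open>z\<close>. One of them is adjacent to \<open>y\<close>, which
    gives a triangle with \<open>a\<close> or with \<open>z\<close>.\<close>
  define Z where "Z = {z \<in> W. z \<notin> A \<and> \<not> (\<exists>a\<in>A. arc z a)}"
  \<comment> \<open>Here \<open>y\<close> is adjacent to all four vertices. An arc from
    \<open>y\<close> to one of them forces, without triangles, an arc to the next, hence to all;
    \<open>y \<notin> A\<close> excludes this.\<close>
  have dominated: "arc p y \<and> arc q y \<and> arc r y \<and> arc s y"
    if "y \<in> W" "y \<notin> A" "part y \<noteq> part p" "part y \<noteq> part q" for y
  proof -
    have "arc y p \<or> arc p y" "arc y q \<or> arc q y" "arc y r \<or> arc r y" "arc y s \<or> arc s y"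
      using tot that in_W parts by metis+
    then show ?thesis
      using no3 that in_W cyc unfolding A_def by blast
  qed
  have "Z = W"
  proof (rule strongD[OF assms(2)])
    show "Z \<subseteq> W" unfolding Z_def by blast
    show "p \<in> Z" unfolding Z_def A_def using in_W arc_asym arc_part by blast
  next
    fix z y assume z: "z \<in> Z" and y: "y \<in> W" "arc z y"
    show "y \<in> Z"
    proof (rule ccontr)
      assume "y \<notin> Z"
      then obtain a where a: "a \<in> A" "arc y a" and yA: "y \<notin> A"
        using z y unfolding Z_def by blast
      have aW: "a \<in> W" and ac: "arc a p" "arc a q" "arc a r" "arc a s"
        using a(1) unfolding A_def by auto
      have zW: "z \<in> W" and zA: "z \<notin> A" and za: "\<not> arc z a"
        using z a unfolding Z_def by auto
      have "\<not> arc a z" using no3 aW zW y a(2) by blast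
      then have "part z = part a" using za tot aW zW by blast
      then have "part z \<noteq> part p" "part z \<noteq> part q" using ac arc_part by metis+
      then have zd: "arc p z" "arc q z" "arc r z" "arc s z"
        using dominated zW zA by blast+
      have "\<not> arc p y" "\<not> arc q y" using no3 aW in_W y(1) ac a(2) by blast+
      moreover have "\<not> arc y p" "\<not> arc y q" using no3 in_W y zW zd by blast+
      ultimately show False using tot in_W y(1) parts(3) by metis
    qed
  qed
  moreover have "u \<in> A" using u uW unfolding A_def by blast
  ultimately show False using uW unfolding Z_def by blast
qed

section \<open>Greedy packing of short cycles\<close>

lemma light_short_dicycle:
  assumes "W \<subseteq> X" "strong W" "\<And>x. x \<in> W \<Longrightarrow> \<exists>y\<in>W. arc x y"
  shows "\<exists>c. short_dicycle c \<and> set c \<subseteq> W \<and> (\<forall>x\<in>W. card {y \<in> set c. arc x y} \<le> 3)"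
proof (cases "triangle_free W")
  case False
  then obtain x y z where c: "x \<in> W" "y \<in> W" "z \<in> W" "arc x y" "arc y z" "arc z x"
    unfolding triangle_free_def by blast
  have "card {w \<in> set [x, y, z]. arc u w} \<le> 3" for u
  proof -
    have "card {w \<in> set [x, y, z]. arc u w} \<le> card (set [x, y, z])"
      by (rule card_mono) auto
    also have "\<dots> \<le> 3" using card_length[of "[x, y, z]"] by simp
    finally show ?thesis .
  qed
  moreover have "short_dicycle [x, y, z]" unfolding short_dicycle_def using c by blast
  moreover have "set [x, y, z] \<subseteq> W" using c by simp
  ultimately show ?thesis by blast
next
  case True
  obtain p q r s where in_W: "p \<in> W" "q \<in> W" "r \<in> W" "s \<in> W"
    and c: "arc p q" "arc q r" "arc r s" "arc s p"
    using strong_has_4_cycle[OF assms(1,2) True assms(3)] by blast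
  have "card {w \<in> set [p, q, r, s]. arc u w} \<le> 3" if "u \<in> W" for u
  proof -
    have "{w \<in> set [p, q, r, s]. arc u w} \<subset> set [p, q, r, s]"
      using strong_no_dominating_vertex[OF assms(1,2) True in_W c that] by auto
    then have "card {w \<in> set [p, q, r, s]. arc u w} < card (set [p, q, r, s])"
      by (rule psubset_card_mono[rotated]) simp
    also have "\<dots> \<le> 4" using card_length[of "[p, q, r, s]"] by simp
    finally show ?thesis by simp
  qed
  moreover have "short_dicycle [p, q, r, s]" unfolding short_dicycle_def using c by blast
  moreover have "set [p, q, r, s] \<subseteq> W" using in_W by simp
  ultimately show ?thesis by blast
qed

text \<open>The bound \<open>3 * k - 2\<close> on out-degrees is vacuous on the empty set, hence the
  separate nonemptiness condition.\<close>

lemma disjoint_short_dicycles: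
  assumes "Y \<subseteq> X" "k \<ge> 1 \<Longrightarrow> Y \<noteq> {}" "\<And>x. x \<in> Y \<Longrightarrow> card {y \<in> Y. arc x y} + 2 \<ge> 3 * k"
  shows "\<exists>C :: nat \<Rightarrow> 'a list. (\<forall>i<k. short_dicycle (C i) \<and> set (C i) \<subseteq> Y) \<and>
           (\<forall>i<k. \<forall>j<k. i \<noteq> j \<longrightarrow> set (C i) \<inter> set (C j) = {})"
  using assms
proof (induction k arbitrary: Y)
  case 0
  then show ?case by simp
next
  case (Suc k)
  have "finite Y" using Suc.prems(1) finite_X finite_subset by blast
  then obtain W where W: "W \<subseteq> Y" "strong W" and closed: "\<forall>x\<in>W. \<forall>y\<in>Y. arc x y \<longrightarrow> y \<in> W"
    using terminal_strong_subset[of Y] Suc.prems(2) by auto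
  have finW: "finite W" using \<open>finite Y\<close> W(1) finite_subset by blast
  \<comment> \<open>\<open>W\<close> is out-closed in \<open>Y\<close>, so no out-neighbours are
    lost, and \<open>3 * (k + 1) - 2 = 3 * k + 1\<close>.\<close>
  have deg: "card {y \<in> W. arc x y} \<ge> 3 * k + 1" if "x \<in> W" for x
  proof -
    have "{y \<in> Y. arc x y} = {y \<in> W. arc x y}" using closed that W(1) by blast
    then show ?thesis using Suc.prems(3)[of x] that W(1) by auto
  qed
  have "\<exists>y\<in>W. arc x y" if "x \<in> W" for x
  proof -
    have "{y \<in> W. arc x y} \<noteq> {}" using deg[OF that] by force
    then show ?thesis by blast
  qed
  then obtain c where c: "short_dicycle c" "set c \<subseteq> W"
    and light: "\<forall>x\<in>W. card {y \<in> set c. arc x y} \<le> 3"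
    using light_short_dicycle[of W] W Suc.prems(1) by blast
  let ?Y = "W - set c"
  have deg': "card {y \<in> ?Y. arc x y} + 3 \<ge> card {y \<in> W. arc x y}" if "x \<in> W" for x
  proof -
    have "card {y \<in> W. arc x y} \<le> card ({y \<in> ?Y. arc x y} \<union> {y \<in> set c. arc x y})"
      by (rule card_mono) (use finW in auto)
    also have "\<dots> \<le> card {y \<in> ?Y. arc x y} + card {y \<in> set c. arc x y}"
      by (rule card_Un_le)
    finally show ?thesis using light that by fastforce
  qed
  have "\<exists>C :: nat \<Rightarrow> 'a list. (\<forall>i<k. short_dicycle (C i) \<and> set (C i) \<subseteq> ?Y) \<and>
           (\<forall>i<k. \<forall>j<k. i \<noteq> j \<longrightarrow> set (C i) \<inter> set (C j) = {})"
  proof (rule Suc.IH)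
    show "?Y \<subseteq> X" using W(1) Suc.prems(1) by blast
    \<comment> \<open>Out-degrees in \<open>W\<close> are at least 4, and \<open>c\<close> takes at
      most three out-neighbours.\<close>
    show "?Y \<noteq> {}" if "k \<ge> 1"
    proof
      assume *: "?Y = {}"
      obtain x where x: "x \<in> W" using W(2) unfolding strong_def by blast
      have "card {y \<in> ?Y. arc x y} = 0" unfolding * by simp
      then show False using deg[OF x] deg'[OF x] that by linarith
    qed
    show "card {y \<in> ?Y. arc x y} + 2 \<ge> 3 * k" if "x \<in> ?Y" for x
      using deg[of x] deg'[of x] that by auto
  qed
  then obtain C where C: "\<forall>i<k. short_dicycle (C i) \<and> set (C i) \<subseteq> ?Y"
    "\<forall>i<k. \<forall>j<k. i \<noteq> j \<longrightarrow> set (C i) \<inter> set (C j) = {}" by blast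
  let ?C = "C(k := c)"
  have "\<forall>i<Suc k. short_dicycle (?C i) \<and> set (?C i) \<subseteq> Y"
    using C(1) c W(1) by (auto simp: less_Suc_eq)
  moreover have "\<forall>i<Suc k. \<forall>j<Suc k. i \<noteq> j \<longrightarrow> set (?C i) \<inter> set (?C j) = {}"
    using C c(2) by (simp add: less_Suc_eq) blast
  ultimately show ?case by blast
qed

end

section \<open>Coloured complete graphs\<close>

lemma complete_graphD:
  assumes "complete_graph V E"
  shows "finite V" "\<And>e. e \<in> E \<Longrightarrow> e \<subseteq> V \<and> card e = 2"
    "\<And>u v. u \<in> V \<Longrightarrow> v \<in> V \<Longrightarrow> u \<noteq> v \<Longrightarrow> {u, v} \<in> E"
  using assms by (auto simp: complete_graph_def simple_graph_def)

lemma cycle_edges_3: "cycle_edges [x, y, z] = {{x, y}, {y, z}, {z, x}}"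
proof -
  have "cycle_edges [x, y, z] = (\<lambda>i. {[x, y, z] ! i, [x, y, z] ! (Suc i mod 3)}) ` {..<3}"
    unfolding cycle_edges_def by auto
  also have "{..<3} = {0, 1, 2 :: nat}" by auto
  finally show ?thesis by simp
qed

lemma cycle_edges_4: "cycle_edges [x, y, z, w] = {{x, y}, {y, z}, {z, w}, {w, x}}"
proof -
  have "cycle_edges [x, y, z, w] = (\<lambda>i. {[x, y, z, w] ! i, [x, y, z, w] ! (Suc i mod 4)}) ` {..<4}"
    unfolding cycle_edges_def by auto
  also have "{..<4} = {0, 1, 2, 3 :: nat}" by auto
  finally show ?thesis by simp
qed

lemma pc_cycle_3:
  assumes "complete_graph V E" "distinct [x, y, z]" "{x, y, z} \<subseteq> V"
    "col {x, y} \<noteq> col {y, z}" "col {y, z} \<noteq> col {z, x}" "col {z, x} \<noteq> col {x, y}"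
  shows "pc_cycle V E col [x, y, z]"
  using assms complete_graphD(3)[OF assms(1)]
  unfolding pc_cycle_def is_cycle_def cycle_edges_3 by auto

lemma pc_cycle_4:
  assumes "complete_graph V E" "distinct [x, y, z, w]" "{x, y, z, w} \<subseteq> V"
    "col {x, y} \<noteq> col {y, z}" "col {y, z} \<noteq> col {z, w}"
    "col {z, w} \<noteq> col {w, x}" "col {w, x} \<noteq> col {x, y}"
  shows "pc_cycle V E col [x, y, z, w]"
  using assms complete_graphD(3)[OF assms(1)]
  unfolding pc_cycle_def is_cycle_def cycle_edges_4 by auto

lemma card_mono_neighbours_le:
  assumes "complete_graph V E" "x \<in> V"
    and S: "S \<subseteq> V - {x}" "\<And>y. y \<in> S \<Longrightarrow> col {x, y} = i"
  shows "card S \<le> max_mono_degree V E col"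
proof (cases "S = {}")
  case False
  note fin = complete_graphD(1)[OF assms(1)]
  have finE: "finite E"
    by (rule finite_subset[of _ "Pow V"]) (use fin complete_graphD(2)[OF assms(1)] in auto)
  have edges: "(\<lambda>y. {x, y}) ` S \<subseteq> {e \<in> color_class E col i. x \<in> e}"
    using complete_graphD(3)[OF assms(1)] assms(2) S unfolding color_class_def by auto
  \<comment> \<open>As \<open>S\<close> is nonempty, colour \<open>i\<close> occurs in
    \<open>E\<close> and so enters the maximum.\<close>
  then have i: "i \<in> col ` E" using False unfolding color_class_def by blast
  have "card S = card ((\<lambda>y. {x, y}) ` S)"
    by (rule card_image[symmetric]) (use S(1) in \<open>auto simp: inj_on_def doubleton_eq_iff\<close>)
  also have "\<dots> \<le> vertex_degree (color_class E col i) x"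
    unfolding vertex_degree_def
    by (rule card_mono[OF _ edges]) (use finE in \<open>simp add: color_class_def\<close>)
  also have "\<dots> \<le> max_degree V (color_class E col i)"
    unfolding max_degree_def by (rule Max_ge) (use fin assms(2) in auto)
  also have "\<dots> \<le> max_mono_degree V E col"
    unfolding max_mono_degree_def by (rule Max_ge) (use finE i in auto)
  finally show ?thesis .
qed simp

section \<open>From the coloured graph to the tournament\<close>

theorem theorem7:
  fixes V :: "'a set" and E :: "'a set set" and col :: "'a set \<Rightarrow> nat" and k n :: nat
  assumes "k \<ge> 1"
    and "complete_graph V E"
    and "card V = n"
    and "int (max_mono_degree V E col) \<le> int n - 3 * int k + 1"
  shows "(\<exists>C :: nat \<Rightarrow> 'a list.
            (\<forall>i<k. pc_cycle V E col (C i) \<and> length (C i) \<le> 4) \<and>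
            (\<forall>i<k. \<forall>j<k. i \<noteq> j \<longrightarrow> set (C i) \<inter> set (C j) = {}))
       \<or> (\<forall>v\<in>V. \<exists>c. pc_cycle V E col c \<and> length c \<in> {3, 4} \<and> v \<in> set c)"
proof (rule disjCI)
  assume "\<not> (\<forall>v\<in>V. \<exists>c. pc_cycle V E col c \<and> length c \<in> {3, 4} \<and> v \<in> set c)"
  then obtain v where v: "v \<in> V"
    and no_pc: "\<And>c. pc_cycle V E col c \<Longrightarrow> length c \<in> {3, 4} \<Longrightarrow> v \<notin> set c"
    by blast
  note fin = complete_graphD(1)[OF assms(2)]
  define arc where
    "arc x y \<longleftrightarrow> x \<in> V - {v} \<and> y \<in> V - {v} \<and> col {x, y} = col {v, y} \<and> col {v, x} \<noteq> col {v, y}" for x y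
  have arc_total: "arc x y \<or> arc y x"
    if "x \<in> V - {v}" "y \<in> V - {v}" "col {v, x} \<noteq> col {v, y}" for x y
  proof (rule ccontr)
    assume "\<not> ?thesis"
    then have "col {x, y} \<noteq> col {v, y}" "col {x, y} \<noteq> col {v, x}"
      using that unfolding arc_def by (auto simp: insert_commute)
    then have "pc_cycle V E col [v, x, y]"
      using that v by (intro pc_cycle_3[OF assms(2)]) (auto simp: insert_commute)
    then show False using no_pc[of "[v, x, y]"] by simp
  qed
  interpret multipartite_tournament "V - {v}" arc "\<lambda>x. col {v, x}"
  proof
    show "finite (V - {v})" using fin by simp
    show "arc x y \<or> arc y x" if "x \<in> V - {v}" "y \<in> V - {v}" "col {v, x} \<noteq> col {v, y}" for x y
      using arc_total that .
  qed (auto simp: arc_def insert_commute)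
  \<comment> \<open>An arc has the colour of the edge from \<open>v\<close> to its head; consecutive
    heads lie in different parts, so consecutive colours differ.\<close>
  have pc: "pc_cycle V E col c \<and> length c \<le> 4" if c: "short_dicycle c" for c
    using c unfolding short_dicycle_def
  proof (elim disjE exE conjE)
    fix x y z assume "c = [x, y, z]" "arc x y" "arc y z" "arc z x"
    then show ?thesis
      unfolding arc_def by (auto intro!: pc_cycle_3[OF assms(2)])
  next
    fix x y z w assume *: "c = [x, y, z, w]" "arc x y" "arc y z" "arc z w" "arc w x"
    then have "x \<noteq> z" "y \<noteq> w" using arc_asym by blast+
    then show ?thesis
      using * unfolding arc_def by (auto intro!: pc_cycle_4[OF assms(2)])
  qed
  \<comment> \<open>Every out-neighbour lies in \<open>T\<close>, so out-degrees within
    \<open>T\<close> are full out-degrees.\<close>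
  define T where "T = {x. \<exists>w. arc w x}"
  have T_sub: "T \<subseteq> V - {v}" unfolding T_def arc_def by blast
  have "T \<noteq> {}"
  proof
    assume "T = {}"
    then have mono: "col {v, x} = col {v, y}" if "x \<in> V - {v}" "y \<in> V - {v}" for x y
      using arc_total that unfolding T_def by blast
    \<comment> \<open>All edges at \<open>v\<close> share one colour, so the monochromatic degree is
      at least \<open>n - 1\<close>, which exceeds \<open>n - 3 * k + 1\<close> for
      \<open>k \<ge> 1\<close>.\<close>
    have "card (V - {v}) \<le> max_mono_degree V E col"
      by (rule card_mono_neighbours_le[OF assms(2) v order_refl, where i = "col {v, SOME x. x \<in> V - {v}}"])
        (metis mono someI)
    then show False using assms(1,3,4) v fin by simp
  qed
  moreover have "card {y \<in> T. arc x y} + 2 \<ge> 3 * k" if x: "x \<in> T" for x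
  proof -
    have xV: "x \<in> V" "x \<noteq> v" using x T_sub by auto
    obtain w where w: "arc w x" using x unfolding T_def by blast
    let ?S = "V - {x} - {y \<in> T. arc x y}"
    have "col {x, y} = col {v, x}" if y: "y \<in> ?S" for y
    proof (rule ccontr)
      assume ne: "col {x, y} \<noteq> col {v, x}"
      have "y \<noteq> v" using ne by (auto simp: insert_commute)
      have "\<not> arc x y" using y unfolding T_def by blast
      then have same: "col {v, x} = col {v, y}"
        using arc_total[of x y] ne xV y \<open>y \<noteq> v\<close> unfolding arc_def by (auto simp: insert_commute)
      then have "w \<noteq> y" using w unfolding arc_def by auto
      \<comment> \<open>The opposite edges \<open>wx\<close> and \<open>yv\<close> have the colour
        of \<open>vx\<close>; \<open>vw\<close> and \<open>xy\<close> do not.\<close>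
      then have "pc_cycle V E col [v, w, x, y]"
        using w ne same xV y v \<open>y \<noteq> v\<close> unfolding arc_def
        by (intro pc_cycle_4[OF assms(2)]) (auto simp: insert_commute)
      then show False using no_pc[of "[v, w, x, y]"] by simp
    qed
    then have "card ?S \<le> max_mono_degree V E col"
      by (intro card_mono_neighbours_le[OF assms(2) xV(1)]) auto
    \<comment> \<open>The 1 counts \<open>x\<close> itself; the out-degree is thus at least
      \<open>n - 1 - (n - 3 * k + 1) = 3 * k - 2\<close>.\<close>
    moreover have "card V \<le> card ?S + card {y \<in> T. arc x y} + 1"
    proof -
      have finT: "finite {y \<in> T. arc x y}" using T_sub fin by (simp add: finite_subset)
      have "card V \<le> card (?S \<union> {y \<in> T. arc x y} \<union> {x})"
        by (rule card_mono) (use fin finT in auto)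
      also have "\<dots> \<le> card ?S + card {y \<in> T. arc x y} + card {x}"
        using card_Un_le[of "?S \<union> {y \<in> T. arc x y}" "{x}"] card_Un_le[of ?S "{y \<in> T. arc x y}"]
        by linarith
      finally show ?thesis by simp
    qed
    ultimately show ?thesis using assms(3,4) by linarith
  qed
  ultimately obtain C :: "nat \<Rightarrow> 'a list" where
    "\<forall>i<k. short_dicycle (C i) \<and> set (C i) \<subseteq> T"
    "\<forall>i<k. \<forall>j<k. i \<noteq> j \<longrightarrow> set (C i) \<inter> set (C j) = {}"
    using disjoint_short_dicycles[OF T_sub, of k] by blast
  then show "\<exists>C :: nat \<Rightarrow> 'a list.
      (\<forall>i<k. pc_cycle V E col (C i) \<and> length (C i) \<le> 4) \<and>
      (\<forall>i<k. \<forall>j<k. i \<noteq> j \<longrightarrow> set (C i) \<inter> set (C j) = {})"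
    using pc by blast
qed

end
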